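(* For a linear group $G$, the following statements are equivalent: (i) $G$ is sequentially Weil complete and does not contain an $f_\omega$-productive sequence; (ii) $G$ is sequentially Weil complete and does not contain an unconditionally $f_\omega$-productive sequence; (iii) $G$ has no nontrivial convergent sequences.
   Context: All topological groups are Hausdorff; $\mathbb N=\{0,1,2,\dots\}$. A linear group is a topological group having a base of neighbourhoods of the identity formed by open subgroups. A convergent sequence is nontrivial if it is not eventually constant. A sequence $\{x_n:n\in\mathbb N\}$ in a topological group is left Cauchy if for every neighbourhood $U$ of the identity there is $k\in\mathbb N$ with $x_l^{-1}x_m\in U$ for all $l,m\ge k$; the group is sequentially Weil complete if every left Cauchy sequence in it converges. Products are ordered: $\prod_{n=0}^m b_n=b_0b_1\cdots b_m$. A sequence $\{b_n:n\in\mathbb N\}$ in a topological group $G$ is productive if $\{\prod_{n=0}^m b_n:m\in\mathbb N\}$ converges to some element of $G$. A sequence $\{a_n:n\in\mathbb N\}$ in $G$ is $f_\omega$-productive if it is faithfully indexed ($a_n\ne a_m$ for $n\neq m$) and $\{a_n^{z(n)}:n\in\mathbb N\}$ is productive for every function $z:\mathbb N\to\mathbb Z$. ($f_\omega$ is the constant function with value $\omega$.) It is unconditionally $f_\omega$-productive if it is faithfully indexed and $\{a_{\varphi(n)}:n\in\mathbb N\}$ is $f_\omega$-productive for every bijection $\varphi:\mathbb N\to\mathbb N$. *)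

theory Defs
  imports "HOL-Analysis.Analysis" "HOL-Algebra.Group"
begin

definition topological_group :: "('a, 'b) monoid_scheme \<Rightarrow> 'a topology \<Rightarrow> bool" where
  "topological_group G T \<longleftrightarrow>
     group G \<and> topspace T = carrier G \<and> Hausdorff_space T \<and>
     continuous_map (prod_topology T T) T (\<lambda>(x, y). x \<otimes>\<^bsub>G\<^esub> y) \<and>
     continuous_map T T (\<lambda>x. inv\<^bsub>G\<^esub> x)"

definition linear_group :: "('a, 'b) monoid_scheme \<Rightarrow> 'a topology \<Rightarrow> bool" where
  "linear_group G T \<longleftrightarrow>
     topological_group G T \<and>
     neighbourhood_base_at \<one>\<^bsub>G\<^esub> (\<lambda>H. subgroup H G \<and> openin T H) T"

text \<open>A neighbourhood need not be open: it is a subset of the space containing an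
  open set around the point.\<close>

definition nbhd_of :: "'a topology \<Rightarrow> 'a \<Rightarrow> 'a set \<Rightarrow> bool" where
  "nbhd_of T x U \<longleftrightarrow> U \<subseteq> topspace T \<and> (\<exists>V. openin T V \<and> x \<in> V \<and> V \<subseteq> U)"

definition left_Cauchy :: "('a, 'b) monoid_scheme \<Rightarrow> 'a topology \<Rightarrow> (nat \<Rightarrow> 'a) \<Rightarrow> bool" where
  "left_Cauchy G T x \<longleftrightarrow>
     range x \<subseteq> carrier G \<and>
     (\<forall>U. nbhd_of T \<one>\<^bsub>G\<^esub> U \<longrightarrow>
        (\<exists>k. \<forall>l\<ge>k. \<forall>m\<ge>k. inv\<^bsub>G\<^esub> (x l) \<otimes>\<^bsub>G\<^esub> x m \<in> U))"

definition seq_Weil_complete :: "('a, 'b) monoid_scheme \<Rightarrow> 'a topology \<Rightarrow> bool" where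
  "seq_Weil_complete G T \<longleftrightarrow>
     (\<forall>x. left_Cauchy G T x \<longrightarrow> (\<exists>g. limitin T x g sequentially))"

text \<open>The ordered product \<open>b 0 \<otimes> b 1 \<otimes> \<dots> \<otimes> b m\<close>; the factors need not commute.\<close>

primrec ordered_prod :: "('a, 'b) monoid_scheme \<Rightarrow> (nat \<Rightarrow> 'a) \<Rightarrow> nat \<Rightarrow> 'a" where
  "ordered_prod G b 0 = b 0"
| "ordered_prod G b (Suc m) = ordered_prod G b m \<otimes>\<^bsub>G\<^esub> b (Suc m)"

definition productive :: "('a, 'b) monoid_scheme \<Rightarrow> 'a topology \<Rightarrow> (nat \<Rightarrow> 'a) \<Rightarrow> bool" where
  "productive G T b \<longleftrightarrow>
     range b \<subseteq> carrier G \<and> (\<exists>g. limitin T (ordered_prod G b) g sequentially)"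

definition f_omega_productive :: "('a, 'b) monoid_scheme \<Rightarrow> 'a topology \<Rightarrow> (nat \<Rightarrow> 'a) \<Rightarrow> bool" where
  "f_omega_productive G T a \<longleftrightarrow>
     range a \<subseteq> carrier G \<and> inj a \<and>
     (\<forall>z :: nat \<Rightarrow> int. productive G T (\<lambda>n. a n [^]\<^bsub>G\<^esub> z n))"

definition unconditionally_f_omega_productive ::
    "('a, 'b) monoid_scheme \<Rightarrow> 'a topology \<Rightarrow> (nat \<Rightarrow> 'a) \<Rightarrow> bool" where
  "unconditionally_f_omega_productive G T a \<longleftrightarrow>
     range a \<subseteq> carrier G \<and> inj a \<and>
     (\<forall>\<phi>. bij \<phi> \<longrightarrow> f_omega_productive G T (\<lambda>n. a (\<phi> n)))"

definition nontrivial_convergent_seq :: "'a topology \<Rightarrow> (nat \<Rightarrow> 'a) \<Rightarrow> bool" where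
  "nontrivial_convergent_seq T x \<longleftrightarrow>
     range x \<subseteq> topspace T \<and> (\<exists>l. limitin T x l sequentially) \<and>
     \<not> (\<exists>c. eventually (\<lambda>n. x n = c) sequentially)"

end

theory Submission
  imports Defs "HOL-Algebra.Generated_Groups"
begin

text \<open>A sequence $a$ converging to the identity has all but finitely many of its terms in any given
  open subgroup $H$; so do all rearrangements of $a$, and powers of elements of $H$ stay in $H$.
  Partial products of such powers therefore form a left Cauchy sequence. Conversely,
  consecutive quotients $x_n^{-1} x_{n+1}$ of a left Cauchy sequence converge to the identity, so if
  convergent sequences are trivial then left Cauchy sequences are eventually constant; and the
  factors of a convergent product are such quotients.\<close>

lemma limitin_group_mult:
  assumes "topological_group G T" "limitin T x l F" "limitin T y k F"
  shows "limitin T (\<lambda>n. x n \<otimes>\<^bsub>G\<^esub> y n) (l \<otimes>\<^bsub>G\<^esub> k) F"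
proof -
  have "limitin (prod_topology T T) (\<lambda>n. (x n, y n)) (l, k) F"
    using assms by (simp add: limitin_pairwise o_def)
  from continuous_map_limit[OF _ this, of T "\<lambda>(x, y). x \<otimes>\<^bsub>G\<^esub> y"] show ?thesis
    using assms(1) by (simp add: topological_group_def o_def)
qed

lemma limitin_group_inv:
  assumes "topological_group G T" "limitin T x l F"
  shows "limitin T (\<lambda>n. inv\<^bsub>G\<^esub> x n) (inv\<^bsub>G\<^esub> l) F"
  using continuous_map_limit[OF _ assms(2), of T "\<lambda>x. inv\<^bsub>G\<^esub> x"] assms(1)
  by (simp add: topological_group_def o_def)

lemma limitin_Suc:
  assumes "limitin T x l sequentially"
  shows "limitin T (\<lambda>n. x (Suc n)) l sequentially"
  using assms unfolding limitin_def eventually_sequentially by (meson le_SucI)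

text \<open>By continuity the two factors converge to the inverse of \<open>l\<close> and to
  \<open>l\<close>. Applied to partial products, this recovers the factors of a convergent
  product.\<close>

lemma limitin_consecutive_quotients:
  assumes G: "topological_group G T" and lim: "limitin T x l sequentially"
  shows "limitin T (\<lambda>n. inv\<^bsub>G\<^esub> x n \<otimes>\<^bsub>G\<^esub> x (Suc n)) \<one>\<^bsub>G\<^esub> sequentially"
proof -
  have "l \<in> carrier G" and "group G"
    using assms by (auto simp: topological_group_def dest: limitin_topspace)
  then show ?thesis
    using limitin_group_mult[OF G limitin_group_inv[OF G lim] limitin_Suc[OF lim]]
    by (simp add: group.l_inv)
qed

lemma inj_imp_not_eventually_const:
  assumes "inj (x :: nat \<Rightarrow> 'a)"
  shows "\<not> eventually (\<lambda>n. x n = c) sequentially"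
proof
  assume "eventually (\<lambda>n. x n = c) sequentially"
  then obtain N where "\<forall>n\<ge>N. x n = c" by (auto simp: eventually_sequentially)
  then have "x N = x (Suc N)" by simp
  then show False using assms by (auto dest: injD)
qed

lemma linear_group_open_subgroup:
  assumes "linear_group G T" "openin T U" "\<one>\<^bsub>G\<^esub> \<in> U"
  obtains H where "subgroup H G" "openin T H" "H \<subseteq> U"
  using assms unfolding linear_group_def neighbourhood_base_at_def by blast

text \<open>Here no limit of \<open>x\<close> is assumed: the Cauchy condition is used at the index
  pair \<open>n\<close>, \<open>Suc n\<close>.\<close>

lemma left_Cauchy_imp_limitin_one:
  assumes "topological_group G T" "left_Cauchy G T x"
  shows "limitin T (\<lambda>n. inv\<^bsub>G\<^esub> x n \<otimes>\<^bsub>G\<^esub> x (Suc n)) \<one>\<^bsub>G\<^esub> sequentially"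
  unfolding limitin_def
proof (intro conjI allI impI)
  show "\<one>\<^bsub>G\<^esub> \<in> topspace T"
    using assms(1) by (simp add: topological_group_def group.is_monoid)
next
  fix U assume "openin T U \<and> \<one>\<^bsub>G\<^esub> \<in> U"
  then have "nbhd_of T \<one>\<^bsub>G\<^esub> U"
    by (auto simp: nbhd_of_def dest: openin_subset)
  then obtain k where "\<forall>l\<ge>k. \<forall>m\<ge>k. inv\<^bsub>G\<^esub> x l \<otimes>\<^bsub>G\<^esub> x m \<in> U"
    using assms(2) unfolding left_Cauchy_def by blast
  then show "eventually (\<lambda>n. inv\<^bsub>G\<^esub> x n \<otimes>\<^bsub>G\<^esub> x (Suc n) \<in> U) sequentially"
    unfolding eventually_sequentially by (meson le_SucI)
qed

text \<open>The quotients of a left Cauchy sequence form a convergent sequence, so they are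
  eventually some constant \<open>c\<close>. Then \<open>c\<close> is also a limit of them, and
  uniqueness of limits forces \<open>c\<close> to be the identity. This argument works in every
  topological group.\<close>

lemma seq_Weil_complete_if_no_nontrivial_convergent_seq:
  assumes G: "topological_group G T" and triv: "\<not> (\<exists>x. nontrivial_convergent_seq T x)"
  shows "seq_Weil_complete G T"
  unfolding seq_Weil_complete_def
proof (intro allI impI)
  fix x assume x: "left_Cauchy G T x"
  interpret group G using G by (simp add: topological_group_def)
  have top: "topspace T = carrier G" and Haus: "Hausdorff_space T"
    using G by (auto simp: topological_group_def)
  have xc [simp]: "x n \<in> carrier G" for n
    using x by (auto simp: left_Cauchy_def)
  let ?q = "\<lambda>n. inv\<^bsub>G\<^esub> x n \<otimes>\<^bsub>G\<^esub> x (Suc n)"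
  have lim: "limitin T ?q \<one>\<^bsub>G\<^esub> sequentially"
    by (rule left_Cauchy_imp_limitin_one[OF G x])
  moreover have "range ?q \<subseteq> topspace T" by (auto simp: top)
  ultimately obtain c where ev: "eventually (\<lambda>n. ?q n = c) sequentially"
    using triv unfolding nontrivial_convergent_seq_def by blast
  then have "c \<in> topspace T"
    using top by (force simp: eventually_sequentially)
  then have "limitin T ?q c sequentially"
    using ev by (auto simp: limitin_def elim: eventually_mono)
  with lim have "c = \<one>\<^bsub>G\<^esub>"
    using limitin_Hausdorff_unique[OF _ _ _ Haus] by force
  with ev obtain N where N: "\<And>n. n \<ge> N \<Longrightarrow> ?q n = \<one>\<^bsub>G\<^esub>"
    by (auto simp: eventually_sequentially)
  have "x n = x N" if "n \<ge> N" for n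
    using that
  proof (induction rule: dec_induct)
    case (step n)
    then show ?case
      using N[of n] inv_solve_left[of "\<one>\<^bsub>G\<^esub>" "x n" "x (Suc n)"] by simp
  qed auto
  then have "limitin T x (x N) sequentially"
    unfolding limitin_def eventually_sequentially by (metis top xc)
  then show "\<exists>g. limitin T x g sequentially" ..
qed

text \<open>With all exponents 1, the partial products of \<open>a\<close> itself converge. The
  quotient of the partial products at \<open>n\<close> and \<open>Suc n\<close> is
  \<open>a (Suc n)\<close>, whence the shift by one. Faithful indexing makes the limit
  nontrivial.\<close>

lemma f_omega_productive_imp_nontrivial_convergent_seq:
  assumes G: "topological_group G T" and a: "f_omega_productive G T a"
  shows "nontrivial_convergent_seq T (\<lambda>n. a (Suc n))"
proof -
  interpret group G using G by (simp add: topological_group_def)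
  have ac [simp]: "a n \<in> carrier G" for n
    using a by (auto simp: f_omega_productive_def)
  have pc [simp]: "ordered_prod G a n \<in> carrier G" for n
    by (induction n) auto
  have "productive G T (\<lambda>n. a n [^]\<^bsub>G\<^esub> z n)" for z :: "nat \<Rightarrow> int"
    using a by (simp add: f_omega_productive_def)
  from this[of "\<lambda>_. 1"] obtain g where "limitin T (ordered_prod G a) g sequentially"
    by (auto simp: productive_def)
  from limitin_consecutive_quotients[OF G this]
  have "limitin T (\<lambda>n. a (Suc n)) \<one>\<^bsub>G\<^esub> sequentially"
    by (simp flip: m_assoc)
  moreover have "inj (\<lambda>n. a (Suc n))"
    using a by (auto simp: f_omega_productive_def inj_def)
  ultimately show ?thesis
    using G inj_imp_not_eventually_const[of "\<lambda>n. a (Suc n)"]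
    by (auto simp: nontrivial_convergent_seq_def topological_group_def)
qed

lemma unconditionally_f_omega_productive_imp_f_omega_productive:
  "unconditionally_f_omega_productive G T a \<Longrightarrow> f_omega_productive G T a"
  unfolding unconditionally_f_omega_productive_def using bij_id by force

text \<open>The quotient telescopes to the product of the factors with indices from
  \<open>Suc l\<close> to \<open>m\<close>, all of which lie in \<open>H\<close>.\<close>

lemma ordered_prod_tail_in_subgroup:
  assumes "group G" "subgroup H G" "range b \<subseteq> carrier G" "\<forall>n\<ge>k. b n \<in> H" "k \<le> l" "l \<le> m"
  shows "inv\<^bsub>G\<^esub> ordered_prod G b l \<otimes>\<^bsub>G\<^esub> ordered_prod G b m \<in> H"
proof -
  interpret group G by fact
  interpret subgroup H G by fact
  have bc [simp]: "b n \<in> carrier G" for n using assms(3) by auto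
  have pc [simp]: "ordered_prod G b n \<in> carrier G" for n
    by (induction n) auto
  show ?thesis using \<open>l \<le> m\<close>
  proof (induction rule: dec_induct)
    case (step n)
    then show ?case using assms(4,5) by (simp flip: m_assoc)
  qed simp
qed

text \<open>Linearity enters here: a neighbourhood of the identity can be shrunk to a subgroup,
  which contains products of arbitrarily many of its elements.\<close>

lemma left_Cauchy_ordered_prod:
  assumes lin: "linear_group G T" and b: "range b \<subseteq> carrier G"
    and fin: "\<And>H. subgroup H G \<Longrightarrow> openin T H \<Longrightarrow> finite {n. b n \<notin> H}"
  shows "left_Cauchy G T (ordered_prod G b)"
proof -
  interpret group G using lin by (simp add: linear_group_def topological_group_def)
  have pc [simp]: "ordered_prod G b n \<in> carrier G" for n
    using b by (induction n) auto
  have "\<exists>k. \<forall>l\<ge>k. \<forall>m\<ge>k. inv\<^bsub>G\<^esub> ordered_prod G b l \<otimes>\<^bsub>G\<^esub> ordered_prod G b m \<in> U"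
    if "nbhd_of T \<one>\<^bsub>G\<^esub> U" for U
  proof -
    from that obtain V where "openin T V" "\<one>\<^bsub>G\<^esub> \<in> V" "V \<subseteq> U"
      by (auto simp: nbhd_of_def)
    then obtain H where H: "subgroup H G" "openin T H" "H \<subseteq> U"
      using linear_group_open_subgroup[OF lin] by (metis subset_trans)
    obtain k where k: "\<forall>n\<ge>k. b n \<in> H"
      using fin[OF H(1,2)] unfolding finite_nat_set_iff_bounded by (metis mem_Collect_eq not_less)
    note tail = ordered_prod_tail_in_subgroup[OF is_group H(1) b k]
    have "inv\<^bsub>G\<^esub> ordered_prod G b l \<otimes>\<^bsub>G\<^esub> ordered_prod G b m \<in> H" if "l \<ge> k" "m \<ge> k" for l m
    \<comment> \<open>The telescoping lemma covers indices in increasing order; the other order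
      gives the inverse of such a quotient.\<close>
    proof (cases "l \<le> m")
      case False
      with that have "inv\<^bsub>G\<^esub> (inv\<^bsub>G\<^esub> ordered_prod G b m \<otimes>\<^bsub>G\<^esub> ordered_prod G b l) \<in> H"
        by (intro subgroup.m_inv_closed[OF H(1)] tail) auto
      then show ?thesis by (simp add: inv_mult_group)
    qed (use that tail in auto)
    with H(3) show ?thesis by blast
  qed
  then show ?thesis by (auto simp: left_Cauchy_def)
qed

lemma unconditionally_f_omega_productive_if_null:
  assumes lin: "linear_group G T" and complete: "seq_Weil_complete G T"
    and a: "range a \<subseteq> carrier G" "inj a"
    and fin: "\<And>H. subgroup H G \<Longrightarrow> openin T H \<Longrightarrow> finite {n. a n \<notin> H}"
  shows "unconditionally_f_omega_productive G T a"
proof -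
  interpret group G using lin by (simp add: linear_group_def topological_group_def)
  have "productive G T (\<lambda>n. a (\<phi> n) [^]\<^bsub>G\<^esub> z n)" if "bij \<phi>" for \<phi> and z :: "nat \<Rightarrow> int"
  proof -
    let ?b = "\<lambda>n. a (\<phi> n) [^]\<^bsub>G\<^esub> z n"
    have b: "range ?b \<subseteq> carrier G" using a by auto
    have "finite {n. ?b n \<notin> H}" if H: "subgroup H G" "openin T H" for H
    proof (rule finite_subset)
      \<comment> \<open>If \<open>a (\<phi> n)\<close> is in \<open>H\<close>, then so is each of
        its integer powers. Hence the exceptional set has a bound that does not depend on
        \<open>z\<close>, and injectivity of \<open>\<phi>\<close> makes it finite.\<close>
      show "{n. ?b n \<notin> H} \<subseteq> \<phi> -` {n. a n \<notin> H}"
        using subgroup_int_pow_closed[OF H(1)] by auto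
      show "finite (\<phi> -` {n. a n \<notin> H})"
        by (intro finite_vimageI fin H bij_is_inj \<open>bij \<phi>\<close>)
    qed
    from left_Cauchy_ordered_prod[OF lin b this] show ?thesis
      using complete b unfolding seq_Weil_complete_def productive_def by blast
  qed
  moreover have "inj (\<lambda>n. a (\<phi> n))" if "bij \<phi>" for \<phi>
    using a(2) that by (auto simp: inj_def bij_def)
  ultimately show ?thesis
    using a by (auto simp: unconditionally_f_omega_productive_def f_omega_productive_def)
qed

text \<open>A convergent sequence may repeat values, while productive sequences must be faithfully
  indexed. So the limit is translated to the identity, and infinitely many distinct non-identity
  values are then listed injectively.\<close>

lemma nontrivial_convergent_seq_imp_null_sequence:
  assumes G: "topological_group G T" and x: "nontrivial_convergent_seq T x"
  obtains a :: "nat \<Rightarrow> 'a" where "range a \<subseteq> carrier G" "inj a"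
    "\<And>U. openin T U \<Longrightarrow> \<one>\<^bsub>G\<^esub> \<in> U \<Longrightarrow> finite {n. a n \<notin> U}"
proof -
  interpret group G using G by (simp add: topological_group_def)
  have top: "topspace T = carrier G" and Haus: "Hausdorff_space T"
    using G by (auto simp: topological_group_def)
  from x obtain l where l: "limitin T x l sequentially"
    and xc [simp]: "\<And>n. x n \<in> carrier G"
    and nonconst: "\<not> eventually (\<lambda>n. x n = l) sequentially"
    by (auto simp: nontrivial_convergent_seq_def top)
  have lc [simp]: "l \<in> carrier G" using limitin_topspace[OF l] top by simp
  define y where "y n = inv\<^bsub>G\<^esub> l \<otimes>\<^bsub>G\<^esub> x n" for n
  have yc [simp]: "y n \<in> carrier G" for n by (simp add: y_def)
  have y1: "y n = \<one>\<^bsub>G\<^esub> \<longleftrightarrow> x n = l" for n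
    unfolding y_def by (metis inv_closed inv_solve_left' l_inv lc one_closed r_one xc)
  have "limitin T (\<lambda>n. inv\<^bsub>G\<^esub> l) (inv\<^bsub>G\<^esub> l) sequentially"
    by (simp add: top)
  from limitin_group_mult[OF G this l] have "limitin T y \<one>\<^bsub>G\<^esub> sequentially"
    by (simp add: y_def[abs_def])
  \<comment> \<open>Convergence is restated as a finite set of exceptions, a form that ignores the
    order of the terms and so survives the choice of \<open>a\<close> below.\<close>
  then have fin: "finite {n. y n \<notin> U}" if "openin T U" "\<one>\<^bsub>G\<^esub> \<in> U" for U
    using that unfolding limitin_def by (simp flip: cofinite_eq_sequentially eventually_cofinite)
  define S where "S = {n. y n \<noteq> \<one>\<^bsub>G\<^esub>}"
  have "infinite S"
    using nonconst unfolding S_def y1 by (simp flip: cofinite_eq_sequentially add: eventually_cofinite)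
  \<comment> \<open>Otherwise, by the pigeonhole principle, \<open>y\<close> would take some value
    \<open>c\<close> other than the identity infinitely often. But a neighbourhood of the identity
    that omits \<open>c\<close> contains all but finitely many terms.\<close>
  have "infinite (y ` S)"
  proof
    assume "finite (y ` S)"
    then obtain c where c: "c \<in> y ` S" "infinite (y -` {c} \<inter> S)"
      using inf_img_fin_domE'[OF _ \<open>infinite S\<close>] by metis
    then have "c \<noteq> \<one>\<^bsub>G\<^esub>" "c \<in> topspace T" by (auto simp: S_def top)
    then obtain U where "openin T U" "\<one>\<^bsub>G\<^esub> \<in> U" "c \<notin> U"
      using Haus top unfolding Hausdorff_space_def disjnt_iff by (metis one_closed)
    then have "finite (y -` {c} \<inter> S)"
      by (auto intro: finite_subset[OF _ fin])
    with c(2) show False by simp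
  qed
  then obtain a :: "nat \<Rightarrow> 'a" where a: "inj a" "range a \<subseteq> y ` S"
    unfolding infinite_iff_countable_subset by blast
  show thesis
  proof
    show "range a \<subseteq> carrier G" "inj a" using a by auto
    fix U assume U: "openin T U" "\<one>\<^bsub>G\<^esub> \<in> U"
    \<comment> \<open>Only finitely many values of \<open>y\<close> lie outside \<open>U\<close>,
      and the injective \<open>a\<close> takes each of them at most once.\<close>
    have "finite (a -` (y ` {n. y n \<notin> U}))"
      by (intro finite_vimageI finite_imageI fin U a)
    moreover have "{n. a n \<notin> U} \<subseteq> a -` (y ` {n. y n \<notin> U})"
    proof
      fix n assume "n \<in> {n. a n \<notin> U}"
      moreover obtain m where "a n = y m" using a(2) by (meson imageE range_subsetD)
      ultimately show "n \<in> a -` (y ` {n. y n \<notin> U})" by simp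
    qed
    ultimately show "finite {n. a n \<notin> U}" by (rule rev_finite_subset)
  qed
qed

theorem theorem6p8:
  fixes G :: "('a, 'b) monoid_scheme" and T :: "'a topology"
  assumes "linear_group G T"
  shows "((seq_Weil_complete G T \<and> \<not> (\<exists>a. f_omega_productive G T a)) \<longleftrightarrow>
          (seq_Weil_complete G T \<and> \<not> (\<exists>a. unconditionally_f_omega_productive G T a))) \<and>
         ((seq_Weil_complete G T \<and> \<not> (\<exists>a. unconditionally_f_omega_productive G T a)) \<longleftrightarrow>
          \<not> (\<exists>x. nontrivial_convergent_seq T x))"
proof -
  have G: "topological_group G T"
    using assms by (simp add: linear_group_def)
  \<comment> \<open>This is the contrapositive of (ii) implies (iii), with completeness kept as a
    hypothesis.\<close>
  have "\<exists>a. unconditionally_f_omega_productive G T a"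
    if complete: "seq_Weil_complete G T" and x: "nontrivial_convergent_seq T x" for x
  proof -
    obtain a :: "nat \<Rightarrow> 'a" where "range a \<subseteq> carrier G" "inj a"
      "\<And>U. openin T U \<Longrightarrow> \<one>\<^bsub>G\<^esub> \<in> U \<Longrightarrow> finite {n. a n \<notin> U}"
      using nontrivial_convergent_seq_imp_null_sequence[OF G x] by metis
    then show ?thesis
      using unconditionally_f_omega_productive_if_null[OF assms complete] subgroup.one_closed
      by metis
  qed
  \<comment> \<open>The cycle closes: (iii) yields (i) through the completeness lemma and the
    sequence \<open>a (Suc n)\<close>, and (i) yields (ii) because unconditional productivity is the
    stronger notion.\<close>
  then show ?thesis
    using seq_Weil_complete_if_no_nontrivial_convergent_seq[OF G]
      f_omega_productive_imp_nontrivial_convergent_seq[OF G]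
      unconditionally_f_omega_productive_imp_f_omega_productive
    by metis
qed

end
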